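(* The generating function $A(u,v,t)=\sum_{r,s,k\ge 0}a(r,s,k)\,u^r\,\frac{v^s t^k}{(s+k)!}$ for the car parking problem is given by $$A(u,v,t)=\frac{1}{1-\frac vt e^t}+\frac{u-\frac vt}{1-\frac vt e^t}\cdot\frac{e^{T(v)}}{1-u\,e^{T(v)}}.$$
   Context: Car parking problem: a car park has $n$ spaces in a line, numbered $1,\dots,n$, and $m$ drivers arrive one after the other. Each driver has chosen a preferred space, so an assignment is a function $f:\{1,\dots,m\}\to\{1,\dots,n\}$. Each arriving driver parks in the chosen space if it is free; otherwise the driver takes the first free space with a larger number, if there is one; if there is none, the driver goes home. For $r,s,k\in\mathbb N_0$, $a(r,s,k)$ denotes the number of assignments of $m=s+k$ drivers to $n=r+s$ spaces for which, in the end, $r$ spaces remain unoccupied, $s$ spaces are occupied, and $k$ drivers go home. (For $n=0$ there is exactly one assignment if $m=0$ and none if $m>0$.) $T$ denotes the tree function, the formal power series $T(v)=\sum_{i=1}^\infty\frac{i^{i-1}}{i!}v^i$, which satisfies $T(v)=v\,e^{T(v)}$. The identity is one of formal series; the right-hand side may be read as a formal power series in $u$ and $v$ whose coefficients are formal Laurent series in $t$ (in that ring $1-\frac vt e^t$ and $1-u\,e^{T(v)}$ are invertible). *)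

theory Defs
  imports
    "HOL-Library.FuncSet"
    "HOL-Computational_Algebra.Formal_Laurent_Series"
begin

definition free_spaces :: "nat \<Rightarrow> nat set \<Rightarrow> nat \<Rightarrow> nat set" where
  "free_spaces n occ p = {q \<in> {1..n}. p \<le> q \<and> q \<notin> occ}"

definition park_step :: "nat \<Rightarrow> nat set \<Rightarrow> nat \<Rightarrow> nat set" where
  "park_step n occ p =
     (if free_spaces n occ p = {} then occ else insert (Min (free_spaces n occ p)) occ)"

primrec occupied :: "nat \<Rightarrow> (nat \<Rightarrow> nat) \<Rightarrow> nat \<Rightarrow> nat set" where
  "occupied n f 0 = {}"
| "occupied n f (Suc j) = park_step n (occupied n f j) (f (Suc j))"

definition going_home :: "nat \<Rightarrow> (nat \<Rightarrow> nat) \<Rightarrow> nat \<Rightarrow> nat set" where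
  "going_home n f m = {j \<in> {1..m}. free_spaces n (occupied n f (j - 1)) (f j) = {}}"

definition parking_count :: "nat \<Rightarrow> nat \<Rightarrow> nat \<Rightarrow> nat" where
  "parking_count r s k =
     (let n = r + s; m = s + k in
      card {f \<in> {1..m} \<rightarrow>\<^sub>E {1..n}.
              card ({1..n} - occupied n f m) = r \<and>
              card (occupied n f m) = s \<and>
              card (going_home n f m) = k})"

text \<open>
  Power series in \<open>u\<close> (outer) and \<open>v\<close> (inner) over the field of formal Laurent
  series in \<open>t\<close>.
\<close>
type_synonym uvt_series = "rat fls fps fps"

definition in_t :: "rat fls \<Rightarrow> uvt_series" where
  "in_t c = fps_const (fps_const c)"

definition in_v :: "rat fls fps \<Rightarrow> uvt_series" where
  "in_v g = fps_const g"

definition u_var :: uvt_series where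
  "u_var = fps_X"

definition v_var :: uvt_series where
  "v_var = in_v fps_X"

definition t_var :: "rat fls" where
  "t_var = fls_X"

definition v_over_t :: uvt_series where
  "v_over_t = v_var * in_t (1 / t_var)"

definition exp_t :: uvt_series where
  "exp_t = in_t (fps_to_fls (fps_exp 1))"

text \<open>
  The case distinction is needed because \<open>0 ^ (0 - 1) = 1\<close> on natural numbers.
\<close>
definition tree_fps :: "'a::field_char_0 fps" where
  "tree_fps = Abs_fps (\<lambda>i. if i = 0 then 0 else of_nat (i ^ (i - 1)) / fact i)"

definition exp_tree_v :: uvt_series where
  "exp_tree_v = in_v (fps_exp 1 oo tree_fps)"

definition parking_gf :: uvt_series where
  "parking_gf = Abs_fps (\<lambda>r. Abs_fps (\<lambda>s. fps_to_fls
     (Abs_fps (\<lambda>k. of_nat (parking_count r s k) / fact (s + k)))))"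

text \<open>
  The coefficient ring of the outer series is not a field, so division of such series
  is only meaningful for suitable denominators. It is the true quotient whenever the
  constant coefficient (in \<open>u\<close> and \<open>v\<close>) of the denominator is nonzero, which
  covers both denominators below.
\<close>
lemma uvt_divide_mult_cancel:
  fixes f g :: uvt_series
  assumes "g $ 0 $ 0 \<noteq> 0"
  shows "f / g * g = f"
proof -
  have sub: "subdegree g = 0"
    using assms by (intro subdegree_eq_0) auto
  have "inverse (g $ 0) * g $ 0 = 1"
    using assms by (simp add: inverse_mult_eq_1)
  hence "g * inverse g = 1"
    by (simp add: fps_inverse_def fps_right_inverse mult.commute)
  thus ?thesis
    using sub by (simp add: fps_divide_def mult.assoc mult.commute)
qed

lemma denominator_exp_t: "(1 - v_over_t * exp_t) $ 0 $ 0 = 1"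
  by (simp add: v_over_t_def v_var_def exp_t_def in_v_def in_t_def)

lemma denominator_exp_tree: "(1 - u_var * exp_tree_v) $ 0 $ 0 = 1"
  by (simp add: u_var_def)

end

theory Submission
  imports Defs
begin

text \<open>
  The proof is the kernel method. Write \<open>p r s\<close> for the series in \<open>t\<close> with coefficients
  \<open>a(r,s,k) / (s+k)!\<close>. Adding one more space at the end of the line only affects the drivers who
  overflow from the old spaces together with those who prefer the new one: if there are any,
  exactly one of them takes the new space. Summed over all assignments this gives, with
  \<open>A\<^sub>0 = A(u,v,0)\<close> the generating function of the assignments for which everybody parks,
  \<open>A = 1 + (v/t) (e^t A - A\<^sub>0) + u A\<^sub>0\<close>, that is,
  \<open>(1 - (v/t) e^t) A = 1 + (u - v/t) A\<^sub>0\<close>.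

  This one equation determines both unknowns because \<open>A\<close> has no negative powers of \<open>t\<close>, so that
  \<open>t = T(v)\<close> may be substituted. Since \<open>T(v) = v e^{T(v)}\<close>, the left-hand side vanishes, and
  \<open>A\<^sub>0 = 1 / (v/T(v) - u) = e^{T(v)} / (1 - u e^{T(v)})\<close> remains. Putting this back into the equation
  gives the theorem.

  Three ingredients carry the argument. The functional equation of the tree function
  (\<open>tree_equation\<close>) is obtained from the explicit coefficients by Abel's binomial identity. The
  effect of a new last space (\<open>occupied_add_space\<close>, \<open>card_going_home_eq_excess\<close>) shows that the
  number of drivers who go home depends only on how many drivers prefer each space, which leads to
  a recurrence for the counts (\<open>overflow_fps_Suc\<close>). The substitution \<open>t = T(v)\<close> is carried out in
  \<open>kernel_method\<close>, for each power of \<open>u\<close> separately.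
\<close>

section \<open>The functional equation of the tree function\<close>

text \<open>
  The sum is the \<open>n\<close>-th finite difference of a polynomial of degree \<open>d < n\<close>. It is also \<open>d!\<close> times
  the coefficient of \<open>X ^ d\<close> in \<open>exp (x X) (exp X - 1) ^ n\<close>, a series divisible by \<open>X ^ n\<close>.
\<close>
lemma alternating_binomial_power_sum:
  fixes x :: "'a::field_char_0"
  assumes "d < n"
  shows "(\<Sum>k\<le>n. of_nat (n choose k) * (-1) ^ (n - k) * (x + of_nat k) ^ d) = 0"
proof -
  let ?e = "fps_exp (1::'a)"
  have shift: "?e - 1 = fps_X * fps_shift 1 ?e"
    by (rule fps_ext) (simp add: fps_exp_def)
  have expand: "fps_exp x * (?e - 1) ^ n =
      (\<Sum>k\<le>n. fps_const (of_nat (n choose k) * (-1) ^ (n - k)) * fps_exp (x + of_nat k))"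
  proof -
    have "(?e - 1) ^ n = (?e + (- 1)) ^ n" by simp
    also have "\<dots> = (\<Sum>k\<le>n. of_nat (n choose k) * ?e ^ k * (- 1) ^ (n - k))"
      by (rule binomial_ring)
    also have "\<dots> = (\<Sum>k\<le>n. fps_const (of_nat (n choose k) * (-1) ^ (n - k)) * fps_exp (of_nat k))"
      by (intro sum.cong refl)
        (simp add: fps_exp_power_mult fps_of_nat[symmetric] mult_ac
          flip: fps_const_mult fps_const_power fps_const_neg)
    finally show ?thesis
      by (simp add: sum_distrib_left fps_exp_add_mult mult_ac)
  qed
  have "fact d * (fps_exp x * (?e - 1) ^ n) $ d =
      (\<Sum>k\<le>n. of_nat (n choose k) * (-1) ^ (n - k) * (x + of_nat k) ^ d)"
    unfolding expand by (simp add: fps_sum_nth sum_distrib_left)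
  moreover have "(fps_exp x * (?e - 1) ^ n) $ d = 0"
    using assms unfolding shift power_mult_distrib
    by (simp add: mult.left_commute[of "fps_exp x"] fps_X_power_mult_nth)
  ultimately show ?thesis by simp
qed

text \<open>
  Abel's binomial identity. Expanding the second factor in powers of \<open>z = y + n + 1\<close> merges the
  remaining powers of \<open>k + 1\<close> into a single one of exponent \<open>n - j - 1\<close>; the sum over \<open>k\<close> is then a
  finite difference of order \<open>n - j\<close>, so that only \<open>z ^ n\<close> survives. For \<open>k = 0\<close> the exponent
  \<open>k - 1\<close> is truncated to \<open>0\<close>, which does no harm because the base is \<open>1\<close>.
\<close>
lemma abel_identity:
  fixes y :: "'a::field_char_0"
  shows "(\<Sum>k\<le>n. of_nat (n choose k) * of_nat ((k + 1) ^ (k - 1)) * (y + of_nat (n - k)) ^ (n - k))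
       = (y + of_nat n + 1) ^ n"
proof -
  define z where "z = y + of_nat n + 1"
  define D where "D = (\<lambda>m. (\<Sum>k\<le>m. of_nat (m choose k) * (-1) ^ (m - k) * (1 + of_nat k :: 'a) ^ (m - 1)))"
  have "(\<Sum>k\<le>n. of_nat (n choose k) * of_nat ((k + 1) ^ (k - 1)) * (y + of_nat (n - k)) ^ (n - k))
      = (\<Sum>k\<le>n. \<Sum>j\<le>n-k. of_nat (n choose k) * of_nat ((n - k) choose j) * z ^ j
            * ((-1) ^ (n - j - k) * (1 + of_nat k) ^ (n - j - 1)))"
  proof (intro sum.cong refl)
    fix k assume k: "k \<in> {..n}"
    have "y + of_nat (n - k) = z + (- (1 + of_nat k))"
      using k by (simp add: z_def of_nat_diff)
    hence "(y + of_nat (n - k)) ^ (n - k) =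
        (\<Sum>j\<le>n-k. of_nat ((n - k) choose j) * z ^ j * (- (1 + of_nat k)) ^ (n - k - j))"
      by (simp only: binomial_ring)
    moreover have "of_nat ((k + 1) ^ (k - 1)) * (- (1 + of_nat k :: 'a)) ^ (n - k - j)
        = (-1) ^ (n - j - k) * (1 + of_nat k) ^ (n - j - 1)" if "j \<le> n - k" for j
    proof (cases "k = 0")
      case False
      have "(1 + of_nat k :: 'a) ^ (n - j - 1) = (1 + of_nat k) ^ (k - 1) * (1 + of_nat k) ^ (n - k - j)"
        using that k False by (simp flip: power_add)
      moreover have "(- (1 + of_nat k :: 'a)) ^ (n - k - j) = (-1) ^ (n - j - k) * (1 + of_nat k) ^ (n - k - j)"
        by (subst power_minus) (simp add: add.commute)
      ultimately show ?thesis by (simp add: mult_ac)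
    qed (simp add: diff_commute)
    ultimately show "of_nat (n choose k) * of_nat ((k + 1) ^ (k - 1)) * (y + of_nat (n - k)) ^ (n - k)
      = (\<Sum>j\<le>n-k. of_nat (n choose k) * of_nat ((n - k) choose j) * z ^ j
            * ((-1) ^ (n - j - k) * (1 + of_nat k) ^ (n - j - 1)))"
      unfolding sum_distrib_left by (simp add: sum_distrib_left mult_ac)
  qed
  also have "\<dots> = (\<Sum>j\<le>n. \<Sum>k\<le>n-j. of_nat (n choose k) * of_nat ((n - k) choose j) * z ^ j
            * ((-1) ^ (n - j - k) * (1 + of_nat k) ^ (n - j - 1)))"
    unfolding sum.Sigma[OF finite_atMost ballI[OF finite_atMost]]
    by (rule sum.reindex_bij_witness[of _ "\<lambda>(j,k). (k,j)" "\<lambda>(k,j). (j,k)"]) auto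
  also have "\<dots> = (\<Sum>j\<le>n. of_nat (n choose j) * z ^ j * D (n - j))"
  proof (intro sum.cong refl)
    fix j assume "j \<in> {..n}"
    have *: "(n choose k) * ((n - k) choose j) = (n choose j) * ((n - j) choose k)" if "k \<le> n - j" for k
    proof -
      have "(n choose k) * ((n - k) choose j) = (n choose (k + j)) * ((k + j) choose k)"
        using choose_mult[of k "k + j" n] that \<open>j \<in> {..n}\<close> by simp
      also have "(k + j) choose k = (k + j) choose j"
        using binomial_symmetric[of k "k + j"] by simp
      also have "(n choose (k + j)) * ((k + j) choose j) = (n choose j) * ((n - j) choose k)"
        using choose_mult[of j "k + j" n] that \<open>j \<in> {..n}\<close> by simp
      finally show ?thesis .
    qed
    show "(\<Sum>k\<le>n-j. of_nat (n choose k) * of_nat ((n - k) choose j) * z ^ j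
            * ((-1) ^ (n - j - k) * (1 + of_nat k) ^ (n - j - 1)))
        = of_nat (n choose j) * z ^ j * D (n - j)"
      unfolding D_def sum_distrib_left
    proof (intro sum.cong refl)
      fix k assume "k \<in> {..n-j}"
      hence "of_nat (n choose k) * of_nat ((n - k) choose j) = (of_nat (n choose j) * of_nat ((n - j) choose k) :: 'a)"
        using *[of k] by (simp flip: of_nat_mult)
      thus "of_nat (n choose k) * of_nat ((n - k) choose j) * z ^ j
            * ((-1) ^ (n - j - k) * (1 + of_nat k) ^ (n - j - 1))
        = of_nat (n choose j) * z ^ j * (of_nat ((n - j) choose k) * (-1) ^ (n - j - k) * (1 + of_nat k) ^ (n - j - 1))"
        by (simp add: mult_ac)
    qed
  qed
  also have "\<dots> = (\<Sum>j\<le>n. if j = n then z ^ n else 0)"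
  proof (intro sum.cong refl)
    fix j assume "j \<in> {..n}"
    hence "n - j - 1 < n - j" if "j \<noteq> n"
      using that by auto
    from alternating_binomial_power_sum[OF this, of 1]
    have "D (n - j) = 0" if "j \<noteq> n"
      using that by (simp add: D_def)
    thus "of_nat (n choose j) * z ^ j * D (n - j) = (if j = n then z ^ n else 0)"
      by (auto simp: D_def)
  qed
  finally show ?thesis by (simp add: z_def)
qed

lemma mult_Suc_div_fact_Suc:
  "of_nat (k + 1) * x / fact (k + 1) = (x / fact k :: 'a::field_char_0)"
proof -
  have "(of_nat (k + 1) :: 'a) \<noteq> 0"
    unfolding of_nat_eq_0_iff by simp
  moreover have "fact (k + 1) = of_nat (k + 1) * (fact k :: 'a)" by simp
  ultimately show ?thesis
    by (simp only: nonzero_mult_divide_mult_cancel_left not_False_eq_True)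
qed

text \<open>
  Both the series with the claimed coefficients and the exponential of the tree function solve
  \<open>W' = W T'\<close> with constant coefficient \<open>1\<close>, and this equation determines \<open>W\<close> recursively. For the
  former it is Abel's identity at \<open>y = 1\<close>.
\<close>
lemma exp_tree_nth:
  "(fps_exp 1 oo tree_fps) $ n = (of_nat ((n + 1) ^ n) / fact (n + 1) :: 'a::field_char_0)"
proof -
  define W :: "'a fps" where "W = Abs_fps (\<lambda>n. of_nat ((n + 1) ^ n) / fact (n + 1))"
  have W_nth: "W $ k = of_nat ((k + 1) ^ (k - 1)) / fact k" for k
  proof (cases k)
    case (Suc m)
    hence "(of_nat ((k + 1) ^ k) :: 'a) = of_nat (k + 1) * of_nat ((k + 1) ^ (k - 1))"
      unfolding of_nat_mult[symmetric] power_Suc[symmetric] by simp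
    thus ?thesis
      unfolding W_def fps_nth_Abs_fps by (simp only: mult_Suc_div_fact_Suc)
  qed (simp add: W_def)
  let ?T = "tree_fps :: 'a fps" and ?E = "fps_exp 1 oo tree_fps :: 'a fps"
  have T0: "?T $ 0 = 0" by (simp add: tree_fps_def)
  have T': "fps_deriv ?T $ k = (1 + of_nat k) ^ k / fact k" for k
    using mult_Suc_div_fact_Suc[of k "(1 + of_nat k) ^ k :: 'a"] by (simp add: tree_fps_def)
  have E': "fps_deriv ?E = ?E * fps_deriv ?T"
    by (simp add: fps_compose_deriv[OF T0])
  have W': "fps_deriv W = W * fps_deriv ?T"
  proof (rule fps_ext)
    fix n
    have "(W * fps_deriv ?T) $ n = (\<Sum>k\<le>n. of_nat ((k + 1) ^ (k - 1)) / fact k *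
        ((1 + of_nat (n - k)) ^ (n - k) / fact (n - k)))"
      by (simp only: fps_mult_nth T' W_nth atMost_atLeast0)
    also have "\<dots> = (\<Sum>k\<le>n. of_nat (n choose k) * of_nat ((k + 1) ^ (k - 1)) * 
        (1 + of_nat (n - k)) ^ (n - k)) / fact n"
      unfolding sum_divide_distrib
      by (intro sum.cong refl) (simp add: binomial_fact)
    also have "\<dots> = (of_nat n + 2) ^ n / fact n"
      unfolding abel_identity by (simp add: add_ac)
    also have "\<dots> = of_nat (n + 1) * (of_nat n + 2) ^ n / fact (n + 1)"
      by (rule mult_Suc_div_fact_Suc[symmetric])
    also have "\<dots> = fps_deriv W $ n"
      by (simp add: W_nth add_ac)
    finally show "fps_deriv W $ n = (W * fps_deriv ?T) $ n" ..
  qed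
  have "W = ?E"
  proof (rule fps_ext)
    fix n show "W $ n = ?E $ n"
    proof (induction n rule: less_induct)
      case (less n)
      show ?case
      proof (cases n)
        case 0 thus ?thesis by (simp add: W_def)
      next
        case (Suc m)
        have "of_nat (m + 1) * W $ (m + 1) = (W * fps_deriv ?T) $ m"
          by (simp flip: W')
        also have "\<dots> = (?E * fps_deriv ?T) $ m"
          unfolding fps_mult_nth by (intro sum.cong refl) (simp add: less Suc del: fps_deriv_nth)
        also have "\<dots> = of_nat (m + 1) * ?E $ (m + 1)"
          by (simp flip: E')
        finally show ?thesis using Suc by (simp del: of_nat_Suc)
      qed
    qed
  qed
  hence "?E $ n = W $ n" by simp
  thus ?thesis unfolding W_def by simp
qed

lemma tree_equation: "(tree_fps :: 'a::field_char_0 fps) = fps_X * (fps_exp 1 oo tree_fps)"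
proof (rule fps_ext)
  fix n show "(tree_fps :: 'a fps) $ n = (fps_X * (fps_exp 1 oo tree_fps)) $ n"
    by (cases n) (simp_all add: exp_tree_nth, simp_all add: tree_fps_def)
qed

section \<open>Adding a space at the end of the car park\<close>

lemma occupied_subset: "occupied n f j \<subseteq> {1..n}"
proof (induction j)
  case (Suc j)
  have "Min (free_spaces n (occupied n f j) p) \<in> free_spaces n (occupied n f j) p"
    if "free_spaces n (occupied n f j) p \<noteq> {}" for p
    using that by (intro Min_in) (auto simp: free_spaces_def)
  with Suc show ?case by (auto simp: park_step_def free_spaces_def)
qed simp

lemma finite_occupied: "finite (occupied n f j)"
  by (rule finite_subset[OF occupied_subset]) simp

lemma going_home_0: "going_home n f 0 = {}"
  by (simp add: going_home_def)

lemma going_home_Suc: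
  "going_home n f (Suc j) = (if free_spaces n (occupied n f j) (f (Suc j)) = {}
     then insert (Suc j) (going_home n f j) else going_home n f j)"
  by (auto simp: going_home_def le_Suc_eq)

lemma finite_going_home: "finite (going_home n f j)"
  by (simp add: going_home_def)

text \<open>
  Each driver either occupies exactly one further space or goes home, so one of the two numbers
  determines the other.
\<close>
lemma card_occupied_plus_card_going_home:
  "card (occupied n f j) + card (going_home n f j) = j"
proof (induction j)
  case (Suc j)
  have "Min (free_spaces n (occupied n f j) p) \<notin> occupied n f j"
    if "free_spaces n (occupied n f j) p \<noteq> {}" for p
    using Min_in[of "free_spaces n (occupied n f j) p"] that by (auto simp: free_spaces_def)
  moreover have "Suc j \<notin> going_home n f j" by (auto simp: going_home_def)
  ultimately show ?case
    using Suc by (simp add: going_home_Suc park_step_def finite_occupied finite_going_home)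
qed (simp add: going_home_0)

text \<open>
  The same drivers arrive at car parks with \<open>n\<close> and with \<open>n + 1\<close> spaces. Every driver takes the
  smallest suitable space, so those who park among the first \<open>n\<close> do the same in both. The new space
  is only ever offered to drivers who are turned away by the smaller car park and are willing to use
  it; the first of them takes it. Drivers whose preference lies beyond the last space count as going
  home, which lets both car parks be compared without restricting the set of drivers.
\<close>
lemma occupied_add_space:
  "occupied (Suc n) f j = occupied n f j \<union>
     (if \<exists>i\<in>going_home n f j. f i \<le> Suc n then {Suc n} else {})"
proof (induction j)
  case 0 show ?case by (simp add: going_home_0)
next
  case (Suc j)
  let ?p = "f (Suc j)" and ?occ = "occupied n f j"
  have occ: "?occ \<subseteq> {1..n}" by (rule occupied_subset)
  define G where "G \<longleftrightarrow> (\<exists>i\<in>going_home n f j. f i \<le> Suc n)"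
  have IH: "occupied (Suc n) f j = ?occ \<union> (if G then {Suc n} else {})"
    using Suc by (simp add: G_def)
  have free: "free_spaces (Suc n) (occupied (Suc n) f j) ?p =
      free_spaces n ?occ ?p \<union> (if ?p \<le> Suc n \<and> \<not> G then {Suc n} else {})"
    using occ by (auto simp: free_spaces_def IH le_Suc_eq)
  let ?F = "free_spaces n ?occ ?p" and ?N = "if ?p \<le> Suc n \<and> \<not> G then {Suc n} else {}"
  have step: "occupied (Suc n) f (Suc j) = (if ?F \<union> ?N = {} then occupied (Suc n) f j
      else insert (Min (?F \<union> ?N)) (occupied (Suc n) f j))"
    by (simp only: occupied.simps park_step_def free)
  show ?case
  proof (cases "?F = {}")
    case True
    hence "(\<exists>i\<in>going_home n f (Suc j). f i \<le> Suc n) \<longleftrightarrow> ?p \<le> Suc n \<or> G"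
      by (simp add: going_home_Suc G_def)
    moreover have "occupied n f (Suc j) = ?occ"
      using True by (simp add: park_step_def)
    ultimately show ?thesis
      unfolding step IH using True by auto
  next
    case False
    have "finite ?F" and "Min ?F \<le> Suc n"
      using False Min_in[of ?F] by (auto simp: free_spaces_def)
    hence "Min (?F \<union> ?N) = Min ?F"
      using False by (simp add: Min_Un min_absorb1 del: Min_le_iff)
    moreover have "(\<exists>i\<in>going_home n f (Suc j). f i \<le> Suc n) \<longleftrightarrow> G"
      using False by (simp add: going_home_Suc G_def)
    moreover have "occupied n f (Suc j) = insert (Min ?F) ?occ"
      using False by (simp add: park_step_def)
    ultimately show ?thesis
      unfolding step IH using False by auto
  qed
qed

section \<open>Counting assignments by overflow\<close>

text \<open>
  The number of drivers with a preference among the first \<open>n\<close> spaces who find none of these free,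
  computed from the numbers of drivers per preferred space alone. The truncated subtraction matters:
  if nobody arrives at the new space, it stays empty and nobody overflows.
\<close>
primrec excess :: "'a set \<Rightarrow> ('a \<Rightarrow> nat) \<Rightarrow> nat \<Rightarrow> nat" where
  "excess S f 0 = 0"
| "excess S f (Suc n) = excess S f n + card {i \<in> S. f i = Suc n} - 1"

text \<open>
  The set \<open>?G\<close> in the proof consists of the drivers turned away by the first \<open>n\<close> spaces who would
  accept space \<open>n + 1\<close>. Unless it is empty, exactly one of them parks there.
\<close>
lemma card_going_home_eq_excess:
  assumes "\<And>i. i \<in> {1..m} \<Longrightarrow> 1 \<le> f i"
  shows "card (going_home n f m) = excess {1..m} f n + card {i \<in> {1..m}. n < f i}"
proof (induction n)
  case 0
  have "going_home 0 f m = {1..m}" by (auto simp: going_home_def free_spaces_def)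
  moreover have "{i \<in> {1..m}. 0 < f i} = {1..m}" using assms by force
  ultimately show ?case by simp
next
  case (Suc n)
  let ?H = "going_home n f m"
  let ?G = "{i \<in> ?H. f i \<le> Suc n}"
  let ?L = "{i \<in> {1..m}. Suc n < f i}" and ?E = "{i \<in> {1..m}. f i = Suc n}"
  have "?H = ?G \<union> ?L"
    by (auto simp: going_home_def free_spaces_def)
  moreover have "?G \<inter> ?L = {}" by auto
  ultimately have H: "card ?H = card ?G + card ?L"
    using card_Un_disjoint[of ?G ?L] by (simp add: finite_going_home)
  have "{i \<in> {1..m}. n < f i} = ?E \<union> ?L" by auto
  hence "card {i \<in> {1..m}. n < f i} = card ?E + card ?L"
    by (simp only:) (rule card_Un_disjoint; auto)
  with H Suc have G: "card ?G = excess {1..m} f n + card ?E" by simp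
  have "Suc n \<notin> occupied n f m" using occupied_subset[of n f m] by auto
  hence "card (occupied (Suc n) f m) = card (occupied n f m) + (if ?G = {} then 0 else 1)"
    unfolding occupied_add_space by (cases "?G = {}") (auto simp: finite_occupied)
  with card_occupied_plus_card_going_home[of n f m] card_occupied_plus_card_going_home[of "Suc n" f m]
  have "card (going_home (Suc n) f m) + (if ?G = {} then 0 else 1) = card ?H"
    by simp
  moreover have "card ?G > 0 \<longleftrightarrow> ?G \<noteq> {}" by (simp add: card_gt_0_iff finite_going_home)
  ultimately show ?case using H G by (auto split: if_splits)
qed

text \<open>
  The recursion chooses the \<open>j\<close> drivers who prefer the last space; \<open>i\<close> is the overflow from the
  spaces before it.
\<close>
primrec overflow_count :: "nat \<Rightarrow> nat \<Rightarrow> nat \<Rightarrow> nat" where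
  "overflow_count 0 m k = (if m = 0 \<and> k = 0 then 1 else 0)"
| "overflow_count (Suc n) m k =
     (\<Sum>j\<le>m. (m choose j) * (\<Sum>i | i \<le> m \<and> i + j - 1 = k. overflow_count n (m - j) i))"

text \<open>
  At most \<open>m\<close> drivers can overflow, and at most \<open>n\<close> can park.
\<close>
lemma overflow_count_eq_0:
  assumes "m < k \<or> n + k < m"
  shows "overflow_count n m k = 0"
  using assms
proof (induction n arbitrary: m k)
  case (Suc n)
  have "overflow_count n (m - j) i = 0" if "j \<le> m" "i + j - 1 = k" for i j
    using that Suc.prems by (intro Suc.IH) linarith
  thus ?case by simp
qed auto

lemma excess_cong:
  assumes "\<And>q. 1 \<le> q \<Longrightarrow> q \<le> n \<Longrightarrow> {i \<in> S. f i = q} = {i \<in> S'. g i = q}"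
  shows "excess S f n = excess S' g n"
  using assms by (induction n) auto

lemma excess_le:
  assumes "finite S"
  shows "excess S f n \<le> card {i \<in> S. 1 \<le> f i \<and> f i \<le> n}"
proof (induction n)
  case (Suc n)
  have "{i \<in> S. 1 \<le> f i \<and> f i \<le> Suc n} = {i \<in> S. 1 \<le> f i \<and> f i \<le> n} \<union> {i \<in> S. f i = Suc n}"
    by auto
  hence "card {i \<in> S. 1 \<le> f i \<and> f i \<le> Suc n} = card {i \<in> S. 1 \<le> f i \<and> f i \<le> n} + card {i \<in> S. f i = Suc n}"
    using assms by (simp only:) (rule card_Un_disjoint; auto)
  with Suc show ?case by simp
qed simp

text \<open>
  Once the set \<open>J\<close> of drivers preferring the last space is fixed, an assignment is the same as an
  assignment of the other drivers to the spaces before it.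
\<close>
lemma card_excess_last_space:
  assumes "J \<subseteq> S"
  shows "card {f \<in> S \<rightarrow>\<^sub>E {1..Suc n}. excess S f (Suc n) = k \<and> {x \<in> S. f x = Suc n} = J}
       = card {g \<in> (S - J) \<rightarrow>\<^sub>E {1..n}. excess (S - J) g n + card J - 1 = k}"
proof (rule bij_betw_same_card)
  let ?A = "{f \<in> S \<rightarrow>\<^sub>E {1..Suc n}. excess S f (Suc n) = k \<and> {x \<in> S. f x = Suc n} = J}"
  let ?B = "{g \<in> (S - J) \<rightarrow>\<^sub>E {1..n}. excess (S - J) g n + card J - 1 = k}"
  let ?ext = "\<lambda>g x. if x \<in> J then Suc n else g x"
  have ex: "excess S f n = excess (S - J) g n"
    if "{x \<in> S. f x = Suc n} = J" "\<And>x. x \<in> S - J \<Longrightarrow> f x = g x" for f g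
    using that by (intro excess_cong) auto
  show "bij_betw (\<lambda>f. restrict f (S - J)) ?A ?B"
  proof (rule bij_betw_byWitness[where f' = ?ext])
    show "\<forall>f\<in>?A. ?ext (restrict f (S - J)) = f"
      by (auto simp: fun_eq_iff PiE_def extensional_def)
    show "\<forall>g\<in>?B. restrict (?ext g) (S - J) = g"
      by (auto simp: fun_eq_iff PiE_def extensional_def)
    show "(\<lambda>f. restrict f (S - J)) ` ?A \<subseteq> ?B"
    proof (rule image_subsetI)
      fix f assume "f \<in> ?A"
      hence f: "f \<in> S \<rightarrow>\<^sub>E {1..Suc n}" and k: "excess S f (Suc n) = k"
        and J: "{x \<in> S. f x = Suc n} = J" by (simp_all only: mem_Collect_eq)
      have "f x \<in> {1..n}" if "x \<in> S - J" for x
        using that J PiE_mem[OF f, of x] by (auto simp: le_Suc_eq)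
      hence "restrict f (S - J) \<in> (S - J) \<rightarrow>\<^sub>E {1..n}" by auto
      moreover have "excess S f n = excess (S - J) (restrict f (S - J)) n"
        using J by (rule ex) simp
      ultimately show "restrict f (S - J) \<in> ?B"
        using k J by simp
    qed
    show "?ext ` ?B \<subseteq> ?A"
    proof (rule image_subsetI)
      fix g assume "g \<in> ?B"
      hence g: "g \<in> (S - J) \<rightarrow>\<^sub>E {1..n}" and k: "excess (S - J) g n + card J - 1 = k"
        by simp_all
      have gx: "g x \<in> {1..n}" if "x \<in> S" "x \<notin> J" for x
        using PiE_mem[OF g, of x] that by simp
      have "?ext g \<in> S \<rightarrow>\<^sub>E {1..Suc n}"
      proof (rule PiE_I)
        fix x assume "x \<in> S"
        thus "?ext g x \<in> {1..Suc n}" using gx[of x] by auto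
      next
        fix x assume "x \<notin> S"
        thus "?ext g x = undefined" using \<open>J \<subseteq> S\<close> PiE_arb[OF g, of x] by auto
      qed
      moreover have J: "{x \<in> S. ?ext g x = Suc n} = J"
        using gx \<open>J \<subseteq> S\<close> by (fastforce split: if_splits)
      moreover have "excess S (?ext g) n = excess (S - J) g n"
        using J by (rule ex) simp
      ultimately show "?ext g \<in> ?A"
        using k by simp
    qed
  qed
qed

lemma sum_Pow_card:
  fixes h :: "nat \<Rightarrow> 'b::semiring_1"
  assumes "finite S"
  shows "(\<Sum>J\<in>Pow S. h (card J)) = (\<Sum>j\<le>card S. of_nat (card S choose j) * h j)"
proof -
  have "(\<Sum>j\<le>card S. \<Sum>J | J \<in> Pow S \<and> card J = j. h (card J)) = (\<Sum>J\<in>Pow S. h (card J))"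
    using assms by (intro sum.group) (auto intro: card_mono)
  moreover have "(\<Sum>J | J \<in> Pow S \<and> card J = j. h (card J)) = of_nat (card S choose j) * h j" for j
    using n_subsets[OF assms, of j] by simp
  ultimately show ?thesis by simp
qed

text \<open>
  The excess is defined for an arbitrary set of drivers, so that the induction can pass from \<open>S\<close> to
  \<open>S - J\<close> without renumbering; the result depends on the cardinality only.
\<close>
lemma card_excess_eq_overflow_count:
  assumes "finite S"
  shows "card {f \<in> S \<rightarrow>\<^sub>E {1..n}. excess S f n = k} = overflow_count n (card S) k"
  using assms
proof (induction n arbitrary: S k)
  case 0
  thus ?case by (cases "S = {}") (auto simp: PiE_eq_empty_iff)
next
  case (Suc n)
  let ?F = "\<lambda>J. {f \<in> S \<rightarrow>\<^sub>E {1..Suc n}. excess S f (Suc n) = k \<and> {x \<in> S. f x = Suc n} = J}"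
  have fin: "finite (T \<rightarrow>\<^sub>E {1..q :: nat})" if "T \<subseteq> S" for T q
    using that Suc.prems by (intro finite_PiE) (auto intro: finite_subset)
  have step: "card (?F J) = (\<Sum>i | i \<le> card S \<and> i + card J - 1 = k. overflow_count n (card S - card J) i)"
    if "J \<subseteq> S" for J
  proof -
    let ?I = "{i. i \<le> card S \<and> i + card J - 1 = k}"
    have bound: "excess (S - J) g n \<le> card S" for g
    proof -
      have "excess (S - J) g n \<le> card {i \<in> S - J. 1 \<le> g i \<and> g i \<le> n}"
        using Suc.prems by (intro excess_le) simp
      also have "\<dots> \<le> card S" using Suc.prems by (intro card_mono) auto
      finally show ?thesis .
    qed
    have "card (?F J) = card {g \<in> (S - J) \<rightarrow>\<^sub>E {1..n}. excess (S - J) g n + card J - 1 = k}"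
      using that by (rule card_excess_last_space)
    also have "{g \<in> (S - J) \<rightarrow>\<^sub>E {1..n}. excess (S - J) g n + card J - 1 = k}
        = (\<Union>i\<in>?I. {g \<in> (S - J) \<rightarrow>\<^sub>E {1..n}. excess (S - J) g n = i})"
      using bound by auto
    also have "card \<dots> = (\<Sum>i\<in>?I. card {g \<in> (S - J) \<rightarrow>\<^sub>E {1..n}. excess (S - J) g n = i})"
      by (intro card_UN_disjoint ballI finite_subset[OF _ fin[of "S - J" n]]) auto
    also have "\<dots> = (\<Sum>i\<in>?I. overflow_count n (card S - card J) i)"
      using Suc.IH[of "S - J"] Suc.prems card_Diff_subset[of J S] that finite_subset[OF that] by simp
    finally show ?thesis .
  qed
  have "{f \<in> S \<rightarrow>\<^sub>E {1..Suc n}. excess S f (Suc n) = k} = (\<Union>J\<in>Pow S. ?F J)" by auto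
  hence "card {f \<in> S \<rightarrow>\<^sub>E {1..Suc n}. excess S f (Suc n) = k} = card (\<Union>J\<in>Pow S. ?F J)"
    by (rule arg_cong)
  also have "\<dots> = (\<Sum>J\<in>Pow S. card (?F J))"
    using Suc.prems by (intro card_UN_disjoint ballI finite_subset[OF _ fin[of S "Suc n"]]) auto
  also have "\<dots> = (\<Sum>J\<in>Pow S. (\<Sum>i | i \<le> card S \<and> i + card J - 1 = k. overflow_count n (card S - card J) i))"
  proof (rule sum.cong[OF refl])
    fix J assume "J \<in> Pow S"
    hence "J \<subseteq> S" by (rule PowD)
    thus "card (?F J) = (\<Sum>i | i \<le> card S \<and> i + card J - 1 = k. overflow_count n (card S - card J) i)"
      by (rule step)
  qed
  also have "\<dots> = overflow_count (Suc n) (card S) k"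
    by (subst sum_Pow_card[OF Suc.prems]) simp
  finally show ?case .
qed

text \<open>
  With \<open>r + s\<close> spaces and \<open>s + k\<close> drivers, the three conditions on an assignment in
  \<open>parking_count_def\<close> are equivalent, so that only the overflow needs to be prescribed.
\<close>
lemma parking_count_eq_overflow_count:
  "parking_count r s k = overflow_count (r + s) (s + k) k"
proof -
  let ?n = "r + s" and ?m = "s + k"
  have "card ({1..?n} - occupied ?n f ?m) = r \<and> card (occupied ?n f ?m) = s \<and> card (going_home ?n f ?m) = k
      \<longleftrightarrow> excess {1..?m} f ?n = k" if f: "f \<in> {1..?m} \<rightarrow>\<^sub>E {1..?n}" for f
  proof -
    have "{i \<in> {1..?m}. ?n < f i} = {}" and "\<And>i. i \<in> {1..?m} \<Longrightarrow> 1 \<le> f i"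
      using PiE_mem[OF f] by fastforce+
    hence home: "card (going_home ?n f ?m) = excess {1..?m} f ?n"
      using card_going_home_eq_excess[of ?m f ?n] by simp
    have "card ({1..?n} - occupied ?n f ?m) = ?n - card (occupied ?n f ?m)"
      using card_Diff_subset[OF finite_occupied occupied_subset, of ?n f ?m] by simp
    with home card_occupied_plus_card_going_home[of ?n f ?m] show ?thesis by auto
  qed
  hence "parking_count r s k = card {f \<in> {1..?m} \<rightarrow>\<^sub>E {1..?n}. excess {1..?m} f ?n = k}"
    unfolding parking_count_def Let_def by (intro arg_cong[where f = card]) blast
  also have "\<dots> = overflow_count ?n ?m k"
    using card_excess_eq_overflow_count[of "{1..?m}" ?n k] by simp
  finally show ?thesis .
qed

section \<open>The recurrence for the overflow series\<close>

definition overflow_fps :: "nat \<Rightarrow> nat \<Rightarrow> rat fps" where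
  "overflow_fps r s = Abs_fps (\<lambda>k. of_nat (parking_count r s k) / fact (s + k))"

lemma overflow_fps_nth:
  "overflow_fps r s $ k = of_nat (overflow_count (r + s) (s + k) k) / fact (s + k)"
  by (simp add: overflow_fps_def parking_count_eq_overflow_count)

text \<open>
  Dividing by \<open>m!\<close> turns the binomial convolution into a product of exponential series. The condition
  \<open>i + j - 1 = k\<close> means \<open>i = k + 1 - j\<close>, except that truncation admits the additional solution
  \<open>i = j = 0\<close> when \<open>k = 0\<close>: this is the case in which the last space stays free.
\<close>
lemma overflow_count_Suc_normalised:
  "(of_nat (overflow_count (Suc n) m k) / fact m :: rat) =
     (\<Sum>j\<le>min m (k + 1). of_nat (overflow_count n (m - j) (k + 1 - j)) / (fact j * fact (m - j)))
     + (if k = 0 then of_nat (overflow_count n m 0) / fact m else 0)"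
proof -
  define w where "w j i = (of_nat (overflow_count n (m - j) i) / (fact j * fact (m - j)) :: rat)" for j i
  have "(of_nat (overflow_count (Suc n) m k) / fact m :: rat) =
      (\<Sum>j\<le>m. \<Sum>i | i \<le> m \<and> i + j - 1 = k. w j i)"
    unfolding overflow_count.simps of_nat_sum of_nat_mult sum_divide_distrib sum_distrib_left w_def
    by (intro sum.cong refl) (simp add: binomial_fact)
  also have "\<dots> = (\<Sum>j\<le>m. (if j \<le> k + 1 then w j (k + 1 - j) else 0) + (if j = 0 \<and> k = 0 then w 0 0 else 0))"
  proof (intro sum.cong refl)
    fix j assume "j \<in> {..m}"
    let ?I = "{i. i \<le> m \<and> i + j - 1 = k}"
    let ?A = "if j \<le> k + 1 then {k + 1 - j} else {}" and ?B = "if j = 0 \<and> k = 0 then {0} else {}"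
    have "(\<Sum>i\<in>?I. w j i) = (\<Sum>i\<in>?A \<union> ?B. w j i)"
    proof (rule sum.mono_neutral_left)
      show "\<forall>i\<in>?A \<union> ?B - ?I. w j i = 0"
      proof
        fix i assume "i \<in> ?A \<union> ?B - ?I"
        hence "m < i" by (auto split: if_splits)
        hence "overflow_count n (m - j) i = 0" by (intro overflow_count_eq_0) linarith
        thus "w j i = 0" by (simp add: w_def)
      qed
    qed (auto split: if_splits)
    also have "\<dots> = (\<Sum>i\<in>?A. w j i) + (\<Sum>i\<in>?B. w j i)"
      by (intro sum.union_disjoint) auto
    finally show "(\<Sum>i\<in>?I. w j i) =
        (if j \<le> k + 1 then w j (k + 1 - j) else 0) + (if j = 0 \<and> k = 0 then w 0 0 else 0)"
      by auto
  qed
  also have "\<dots> = (\<Sum>j\<le>min m (k + 1). w j (k + 1 - j)) + (if k = 0 then w 0 0 else 0)"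
  proof -
    have "(\<Sum>j\<le>m. if j \<le> k + 1 then w j (k + 1 - j) else 0) = (\<Sum>j\<le>min m (k + 1). w j (k + 1 - j))"
      by (intro sum.mono_neutral_cong_right) auto
    moreover have "(\<Sum>j\<le>m. if j = 0 \<and> k = 0 then w 0 0 else 0) = (if k = 0 then w 0 0 else 0)"
      by (cases "k = 0") simp_all
    ultimately show ?thesis by (simp add: sum.distrib)
  qed
  finally show ?thesis by (simp add: w_def)
qed

text \<open>
  If all spaces remain free, nobody was looking for one: the only contribution is \<open>k = 0\<close>.
\<close>
lemma overflow_fps_0: "overflow_fps r 0 = 1"
proof (rule fps_ext)
  fix k show "overflow_fps r 0 $ k = 1 $ k"
  proof (induction r)
    case (Suc r)
    have "overflow_count r (k - j) (Suc k - j) = 0" if "j \<le> k" for j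
      using that by (intro overflow_count_eq_0) linarith
    hence "overflow_fps (Suc r) 0 $ k = (if k = 0 then overflow_fps r 0 $ k else 0)"
      unfolding overflow_fps_nth add_Suc overflow_count_Suc_normalised
      by (simp add: overflow_count_eq_0)
    thus ?case using Suc by (cases "k = 0") simp_all
  qed (simp add: overflow_fps_nth)
qed

definition all_park_fps :: "nat \<Rightarrow> rat fps" where
  "all_park_fps r = Abs_fps (\<lambda>s. overflow_fps r s $ 0)"

text \<open>
  If the last space stays free, everybody parks, and removing that space leaves an assignment with
  \<open>r - 1\<close> free spaces. For \<open>r = 0\<close> no space is free; the value \<open>1\<close> then accounts for the empty car
  park, so that the coefficient at \<open>s = 0\<close> is \<open>1\<close> for every \<open>r\<close>.
\<close>
definition last_free_fps :: "nat \<Rightarrow> rat fps" where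
  "last_free_fps r = (if r = 0 then 1 else all_park_fps (r - 1))"

text \<open>
  The factor \<open>fps_exp 1\<close> adds the drivers who prefer the last space. One driver fewer overflows than
  arrives there, hence the factor \<open>fps_X\<close> on the left; the constant coefficient is subtracted because
  an occupied last space requires somebody to arrive.
\<close>
lemma overflow_fps_Suc:
  "fps_X * overflow_fps r (Suc s) = fps_exp 1 * overflow_fps r s - fps_const (overflow_fps r s $ 0)
     + fps_X * fps_const (last_free_fps r $ Suc s)"
proof (rule fps_ext)
  fix k'
  show "(fps_X * overflow_fps r (Suc s)) $ k' = (fps_exp 1 * overflow_fps r s - fps_const (overflow_fps r s $ 0)
     + fps_X * fps_const (last_free_fps r $ Suc s)) $ k'"
  proof (cases k')
    case (Suc k)
    let ?n = "r + s"
    have "(fps_exp 1 * overflow_fps r s) $ (k + 1) = (\<Sum>j\<le>k+1.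
        of_nat (overflow_count ?n (Suc s + k - j) (k + 1 - j)) / (fact j * fact (Suc s + k - j)))"
      unfolding fps_mult_nth atMost_atLeast0
      by (intro sum.cong refl) (simp add: overflow_fps_nth)
    moreover have "of_nat (overflow_count ?n (Suc s) 0) / fact (Suc s) = last_free_fps r $ Suc s"
      by (cases r) (simp_all add: overflow_count_eq_0 last_free_fps_def all_park_fps_def overflow_fps_nth)
    moreover have "min (Suc s + k) (k + 1) = k + 1" by simp
    ultimately have "overflow_fps r (Suc s) $ k = (fps_exp 1 * overflow_fps r s) $ (k + 1)
        + (if k = 0 then last_free_fps r $ Suc s else 0)"
      unfolding overflow_fps_nth add_Suc_right[of r s] overflow_count_Suc_normalised by simp
    thus ?thesis using Suc by simp
  qed simp
qed

section \<open>Eliminating the overflow variable\<close>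

text \<open>
  In terms of \<open>P = (\<Sum>s. p s * v ^ s)\<close> and \<open>a = (\<Sum>s. p s $ 0 * v ^ s)\<close> the assumptions say
  \<open>(t - v e^t) P = t b - v a\<close>. For \<open>t = T(v)\<close> the left-hand side vanishes, and \<open>v a = T b\<close>, where
  \<open>T = v e^T\<close>, gives the claim. Here the substitution is made in each \<open>p s\<close>, giving \<open>q s\<close>, so
  that \<open>fps_X\<close> stands for \<open>t\<close> before and for \<open>v\<close> after it. The equations for \<open>s < N\<close>, added up with
  weights \<open>v^(s+1)\<close>, telescope to \<open>T v^N q N\<close>, which does not contribute to the coefficients up to \<open>N\<close>.
\<close>
lemma kernel_method:
  fixes p :: "nat \<Rightarrow> 'a::field_char_0 fps" and b :: "'a fps"
  assumes init: "p 0 = fps_const (b $ 0)"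
    and rec: "\<And>s. fps_X * p (Suc s) =
      fps_exp 1 * p s - fps_const (p s $ 0) + fps_X * fps_const (b $ Suc s)"
  shows "Abs_fps (\<lambda>s. p s $ 0) = (fps_exp 1 oo tree_fps) * b"
proof -
  define a where "a = Abs_fps (\<lambda>s. p s $ 0)"
  let ?T = "tree_fps :: 'a fps" and ?E = "fps_exp 1 oo tree_fps :: 'a fps"
  define q where "q s = p s oo ?T" for s
  have T0: "?T $ 0 = 0" by (simp add: tree_fps_def)
  have rec_q: "?T * q (Suc s) = ?E * q s - fps_const (a $ s) + ?T * fps_const (b $ Suc s)" for s
  proof -
    have "(fps_X * p (Suc s)) oo ?T = (fps_exp 1 * p s - fps_const (p s $ 0) + fps_X * fps_const (b $ Suc s)) oo ?T"
      by (simp only: rec)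
    thus ?thesis
      by (simp add: q_def a_def T0 fps_compose_mult_distrib fps_compose_add_distrib
          fps_compose_sub_distrib fps_X_fps_compose_startby0)
  qed
  have telescope: "?T * fps_X ^ N * q N =
      ?T * (\<Sum>s\<le>N. fps_const (b $ s) * fps_X ^ s) - fps_X * (\<Sum>s<N. fps_const (a $ s) * fps_X ^ s)" for N
  proof (induction N)
    case 0
    show ?case by (simp add: q_def init)
  next
    case (Suc N)
    have "?T * fps_X ^ Suc N * q (Suc N) = fps_X ^ Suc N * (?T * q (Suc N))"
      by (simp add: mult_ac)
    also have "\<dots> = (fps_X * ?E) * fps_X ^ N * q N - fps_X * (fps_const (a $ N) * fps_X ^ N)
        + ?T * (fps_const (b $ Suc N) * fps_X ^ Suc N)"
      by (simp add: rec_q algebra_simps)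
    also have "fps_X * ?E = ?T" by (rule tree_equation[symmetric])
    finally show ?case
      unfolding Suc.IH by (simp add: algebra_simps)
  qed
  have "?T * b = fps_X * a"
  proof (rule fps_ext)
    fix n
    have trunc: "(\<Sum>s\<le>n. fps_const (f $ s) * fps_X ^ s) $ i = f $ i" if "i \<le> n" for f :: "'a fps" and i n
      using that by (simp add: fps_sum_nth fps_X_power_nth if_distrib cong: if_cong)
    have "(?T * b) $ n = (?T * (\<Sum>s\<le>n. fps_const (b $ s) * fps_X ^ s)) $ n"
      unfolding fps_mult_nth by (intro sum.cong refl) (simp add: trunc)
    also have "\<dots> = (?T * fps_X ^ n * q n) $ n + (fps_X * (\<Sum>s<n. fps_const (a $ s) * fps_X ^ s)) $ n"
      by (simp add: telescope)
    also have "?T * fps_X ^ n * q n = fps_X ^ n * (?T * q n)" by (simp add: mult_ac)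
    also have "(fps_X ^ n * (?T * q n)) $ n = 0"
      by (simp add: fps_X_power_mult_nth T0)
    also have "(fps_X * (\<Sum>s<n. fps_const (a $ s) * fps_X ^ s)) $ n = (fps_X * a) $ n"
      by (cases n) (simp_all add: trunc lessThan_Suc_atMost)
    finally show "(?T * b) $ n = (fps_X * a) $ n" by simp
  qed
  hence "fps_X * (?E * b) = fps_X * a"
    by (simp add: mult.assoc[symmetric] flip: tree_equation)
  thus ?thesis by (simp add: a_def)
qed

lemma all_park_fps_step: "all_park_fps r = (fps_exp 1 oo tree_fps) * last_free_fps r"
  unfolding all_park_fps_def
proof (rule kernel_method)
  show "overflow_fps r 0 = fps_const (last_free_fps r $ 0)"
    by (simp add: overflow_fps_0 last_free_fps_def all_park_fps_def)
qed (rule overflow_fps_Suc)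

section \<open>The generating function\<close>

definition coeffs_to_fls :: "rat fps \<Rightarrow> rat fls fps" where
  "coeffs_to_fls f = Abs_fps (\<lambda>s. fls_const (f $ s))"

lemma coeffs_to_fls_nth [simp]: "coeffs_to_fls f $ s = fls_const (f $ s)"
  by (simp add: coeffs_to_fls_def)

lemma fls_const_sum: "fls_const (sum f A) = (\<Sum>i\<in>A. fls_const (f i))"
  by (induction A rule: infinite_finite_induct) (simp_all flip: fls_plus_const)

lemma coeffs_to_fls_mult: "coeffs_to_fls (f * g) = coeffs_to_fls f * coeffs_to_fls g"
  by (rule fps_ext) (simp add: fps_mult_nth fls_const_sum)

text \<open>
  The tree series is defined over each field separately, so the coefficients have to be compared.
\<close>
lemma coeffs_to_fls_exp_tree: "coeffs_to_fls (fps_exp 1 oo tree_fps) = fps_exp 1 oo tree_fps"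
proof (rule fps_ext)
  fix s
  have "fls_const (of_nat a / of_nat b :: rat) = of_nat a / of_nat b" for a b
    by (simp only: fls_of_nat fls_const_divide_const)
  from this[of _ "fact _"]
  have "fls_const (of_nat a / fact b :: rat) = of_nat a / fact b" for a b
    by (simp only: of_nat_fact)
  thus "coeffs_to_fls (fps_exp 1 oo tree_fps) $ s = (fps_exp 1 oo tree_fps) $ s"
    by (simp only: coeffs_to_fls_nth exp_tree_nth)
qed

definition all_park_gf :: uvt_series where
  "all_park_gf = Abs_fps (\<lambda>r. coeffs_to_fls (all_park_fps r))"

text \<open>
  \<open>all_park_fps_step\<close> for all powers of \<open>u\<close> at once: the series \<open>last_free_fps r\<close> are the coefficients of
  \<open>1 + u_var * all_park_gf\<close>.
\<close>
lemma all_park_gf_eq: "all_park_gf * (1 - u_var * exp_tree_v) = exp_tree_v"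
proof -
  have "all_park_gf $ r = (fps_exp 1 oo tree_fps) * (1 + u_var * all_park_gf) $ r" for r
    using arg_cong[OF all_park_fps_step[of r], of coeffs_to_fls]
    by (cases r) (simp_all add: all_park_gf_def coeffs_to_fls_mult coeffs_to_fls_exp_tree
        last_free_fps_def u_var_def fps_eq_iff[of "coeffs_to_fls 1"])
  hence "all_park_gf $ r = (exp_tree_v * (1 + u_var * all_park_gf)) $ r" for r
    unfolding exp_tree_v_def in_v_def fps_mult_left_const_nth .
  hence "all_park_gf = exp_tree_v * (1 + u_var * all_park_gf)"
    by (rule fps_ext)
  thus ?thesis by algebra
qed

text \<open>
  \<open>overflow_fps_0\<close> and \<open>overflow_fps_Suc\<close> for all \<open>r\<close> and \<open>s\<close> at once, the latter divided by \<open>t\<close>. The equation lives over Laurent series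
  although \<open>parking_gf\<close> itself has only nonnegative powers of \<open>t\<close>.
\<close>
lemma parking_gf_equation:
  "parking_gf * (1 - v_over_t * exp_t) = 1 + (u_var - v_over_t) * all_park_gf"
proof -
  have "parking_gf $ r $ s = (v_over_t * exp_t * parking_gf + 1 + (u_var - v_over_t) * all_park_gf) $ r $ s" for r s
  proof -
    have P: "parking_gf $ r $ s = fps_to_fls (overflow_fps r s)" for r s
      by (simp add: parking_gf_def overflow_fps_def)
    \<comment> \<open>An opaque name for \<open>1/t\<close>, which simplification would turn into a shift of coefficients.\<close>
    define c where "c = (1 / fls_X :: rat fls)"
    have c: "c * fls_X = 1" by (rule iffD1[OF nonzero_eq_divide_eq c_def]) simp
    have "(fps_const fps_X * (fps_const (fps_const c) * F)) $ r $ s = (if s = 0 then 0 else c * F $ r $ (s - 1))"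
      for F :: uvt_series and r s by (simp del: fps_const_mult)
    hence vt: "(v_over_t * F) $ r $ s = (if s = 0 then 0 else c * F $ r $ (s - 1))" for F r s
      by (simp only: v_over_t_def v_var_def in_v_def in_t_def t_var_def mult.assoc c_def)
    have et: "(exp_t * F) $ r $ s = fps_to_fls (fps_exp 1) * F $ r $ s" for F r s
      by (simp add: exp_t_def in_t_def)
    have u: "(1 + u_var * all_park_gf) $ r $ s = fls_const (last_free_fps r $ s)"
      by (cases r) (simp_all add: u_var_def all_park_gf_def last_free_fps_def)
    have expand: "(v_over_t * exp_t * parking_gf + 1 + (u_var - v_over_t) * all_park_gf) $ r $ s
        = (v_over_t * (exp_t * parking_gf)) $ r $ s + (1 + u_var * all_park_gf) $ r $ s - (v_over_t * all_park_gf) $ r $ s"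
      by (simp add: algebra_simps)
    show ?thesis
    proof (cases "s = 0")
      case True
      thus ?thesis
        unfolding expand P vt u by (simp add: overflow_fps_0 last_free_fps_def all_park_fps_def)
    next
      case False
      then obtain s' where Suc: "s = Suc s'" by (cases s) auto
      have "fls_X * fps_to_fls (overflow_fps r s) = fps_to_fls (fps_exp 1) * fps_to_fls (overflow_fps r s')
          - fls_const (all_park_fps r $ s') + fls_X * fls_const (last_free_fps r $ s)"
        using arg_cong[OF overflow_fps_Suc[of r s'], of fps_to_fls] Suc
        by (simp add: fls_times_fps_to_fls all_park_fps_def)
      hence "fps_to_fls (overflow_fps r s) = c * (fps_to_fls (fps_exp 1) * fps_to_fls (overflow_fps r s'))
          + fls_const (last_free_fps r $ s) - c * fls_const (all_park_fps r $ s')"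
        using c by algebra
      thus ?thesis
        unfolding expand P vt et u by (simp add: Suc all_park_gf_def)
    qed
  qed
  hence "parking_gf = v_over_t * exp_t * parking_gf + 1 + (u_var - v_over_t) * all_park_gf"
    by (intro fps_ext)
  thus ?thesis by algebra
qed

theorem lemma4:
  shows "parking_gf =
    1 / (1 - v_over_t * exp_t)
    + (u_var - v_over_t) / (1 - v_over_t * exp_t) * (exp_tree_v / (1 - u_var * exp_tree_v))"
proof -
  let ?D = "1 - v_over_t * exp_t" and ?E = "1 - u_var * exp_tree_v"
  \<comment> \<open>The series in \<open>u\<close> do not form a field, so the quotients are kept as opaque factors.\<close>
  have regroup: "a * d + b * d * h = (a + b * h) * d" for a b d h :: uvt_series
    by algebra
  have D: "f / ?D * ?D = f" and E: "f / ?E * ?E = f" for f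
    by (rule uvt_divide_mult_cancel; simp only: denominator_exp_t denominator_exp_tree; simp)+
  have ne: "?D \<noteq> 0" "?E \<noteq> 0"
    using denominator_exp_t denominator_exp_tree fps_zero_nth zero_neq_one by metis+
  have "all_park_gf = exp_tree_v / ?E"
    using all_park_gf_eq E[of exp_tree_v] ne(2) by (metis mult_right_cancel)
  hence "parking_gf * ?D = 1 + (u_var - v_over_t) * (exp_tree_v / ?E)"
    using parking_gf_equation by simp
  also have "\<dots> = 1 / ?D * ?D + (u_var - v_over_t) / ?D * ?D * (exp_tree_v / ?E)"
    by (simp only: D)
  also have "\<dots> = (1 / ?D + (u_var - v_over_t) / ?D * (exp_tree_v / ?E)) * ?D"
    by (rule regroup)
  finally show ?thesis using ne(1) by (metis mult_right_cancel)
qed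

end
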